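(* For every positive integer $n$, writing the $n$-th $P$-sequence as $P_n=\langle a_0,\dots,a_k\rangle$ and setting $F_{n,s}(x)=\sum_{i=0}^k a_i(i+x)^s$, for every integer $s\ge n$ the polynomial $F_{n,s}$ has degree exactly $s-n$ (in particular $F_{n,n}$ is a nonzero constant).
   Context: Convention: $0^0=1$. $P$-sequences are finite sequences of integers defined recursively: $\langle 1,-1\rangle$ is a $P$-sequence; if $\langle a_0,\dots,a_k\rangle$ is a $P$-sequence with $a_0=-a_k$, then $\langle a_0,\dots,a_k,a_k,\dots,a_0\rangle$ (the sequence followed by its reversal) is a $P$-sequence; if $\langle a_0,\dots,a_k\rangle$ is a $P$-sequence with $a_0=a_k$, then $\langle a_0,\dots,a_{k-1},0,-a_{k-1},\dots,-a_0\rangle$ is a $P$-sequence; and every $P$-sequence arises by finitely many applications of these clauses. Ordering $P$-sequences by increasing length, $P_n$ denotes the $n$-th one; e.g. $P_1=\langle 1,-1\rangle$, $P_2=\langle 1,-1,-1,1\rangle$, $P_3=\langle 1,-1,-1,0,1,1,-1\rangle$. For $P_n=\langle a_0,\dots,a_k\rangle$ and integer $s\ge 0$, $F_{n,s}(x)=\sum_{i=0}^k a_i(i+x)^s$. *)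

theory Defs
  imports "HOL-Computational_Algebra.Polynomial" "HOL-Library.Infinite_Set"
begin

inductive P_sequence :: "int list \<Rightarrow> bool" where
  base: "P_sequence [1, -1]"
| double: "P_sequence as \<Longrightarrow> hd as = - last as \<Longrightarrow> P_sequence (as @ rev as)"
| fold_zero: "P_sequence as \<Longrightarrow> hd as = last as \<Longrightarrow>
    P_sequence (butlast as @ [0] @ map uminus (rev (butlast as)))"

text \<open>
  The \<open>n\<close>-th \<open>P\<close>-sequence, counting from \<open>n = 1\<close>, in the order of increasing length.
  Since \<open>enumerate\<close> counts from \<open>0\<close>, the index is shifted; the value at \<open>n = 0\<close> is junk.
  The description is proper for every \<open>n\<close>, see \<open>P_seq_ex1\<close> below.
\<close>

definition P_seq :: "nat \<Rightarrow> int list" where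
  "P_seq n = (THE as. P_sequence as \<and>
     length as = enumerate (length ` {bs. P_sequence bs}) (n - 1))"

definition F :: "nat \<Rightarrow> nat \<Rightarrow> int poly" where
  "F n s = (\<Sum>i<length (P_seq n). smult (P_seq n ! i) ([:int i, 1:] ^ s))"

lemma poly_F: "poly (F n s) x = (\<Sum>i<length (P_seq n). (P_seq n ! i) * (int i + x) ^ s)"
  by (simp add: F_def poly_sum poly_power)

text \<open>
  Every \<open>P\<close>-sequence has exactly one successor, so the \<open>P\<close>-sequences form a chain of strictly
  increasing lengths.
\<close>

definition P_step :: "int list \<Rightarrow> int list" where
  "P_step as = (if hd as = last as then butlast as @ [0] @ map uminus (rev (butlast as))
                else as @ rev as)"

lemma P_sequence_shape:
  "P_sequence as \<Longrightarrow> length as \<ge> 2 \<and> hd as = 1 \<and> (last as = 1 \<or> last as = -1)"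
proof (induction rule: P_sequence.induct)
  case (double as)
  then show ?case by (cases as) (auto simp: hd_append last_append last_rev)
next
  case (fold_zero as)
  then have "length as \<ge> 2" by blast
  then obtain x y bs where "as = x # y # bs"
    by (auto simp: numeral_2_eq_2 Suc_le_length_iff)
  with fold_zero show ?case by (auto simp: hd_append last_append)
qed auto

lemma P_sequence_step: "P_sequence as \<Longrightarrow> P_sequence (P_step as)"
  using P_sequence_shape[of as] P_sequence.double[of as] P_sequence.fold_zero[of as]
  unfolding P_step_def by force

lemma P_sequence_iff: "P_sequence as \<longleftrightarrow> (\<exists>m. as = (P_step ^^ m) [1, -1])"
proof
  show "\<exists>m. as = (P_step ^^ m) [1, -1]" if "P_sequence as"
    using that
  proof (induction rule: P_sequence.induct)
    case base
    show ?case by (rule exI[of _ 0]) simp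
  next
    case (double as)
    then obtain m where m: "as = (P_step ^^ m) [1, -1]" by blast
    have "hd as \<noteq> last as" using double P_sequence_shape[of as] by auto
    then have "as @ rev as = (P_step ^^ Suc m) [1, -1]"
      using m by (simp add: P_step_def)
    then show ?case by blast
  next
    case (fold_zero as)
    then obtain m where m: "as = (P_step ^^ m) [1, -1]" by blast
    then have "butlast as @ [0] @ map uminus (rev (butlast as)) = (P_step ^^ Suc m) [1, -1]"
      using fold_zero by (simp add: P_step_def)
    then show ?case by blast
  qed
next
  have "P_sequence ((P_step ^^ m) [1, -1])" for m
    by (induction m) (simp_all add: P_sequence.base P_sequence_step)
  then show "P_sequence as" if "\<exists>m. as = (P_step ^^ m) [1, -1]" using that by blast
qed

lemma strict_mono_length_P_step: "strict_mono (\<lambda>m. length ((P_step ^^ m) [1, -1]))"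
proof (rule strict_mono_Suc_iff[THEN iffD2], rule allI)
  fix m
  have "length ((P_step ^^ m) [1, -1]) \<ge> 2" using P_sequence_shape P_sequence_iff by blast
  then show "length ((P_step ^^ m) [1, -1]) < length ((P_step ^^ Suc m) [1, -1])"
    by (auto simp: P_step_def)
qed

lemma enumerate_range_strict_mono:
  fixes f :: "nat \<Rightarrow> nat"
  assumes "strict_mono f"
  shows "enumerate (range f) m = f m"
proof -
  have inf: "infinite (range f)"
    using assms strict_mono_imp_inj_on[of f] range_inj_infinite by blast
  show ?thesis
  proof (induction m)
    case 0
    show ?case unfolding enumerate_0
      by (rule Least_equality) (use assms in \<open>auto simp: strict_mono_less_eq\<close>)
  next
    case (Suc m)
    show ?case unfolding enumerate_Suc''[OF inf] Suc
      by (rule Least_equality) (use assms in \<open>auto simp: strict_mono_less strict_mono_less_eq\<close>)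
  qed
qed

lemma length_P_sequence_iff:
  "P_sequence as \<and> length as = enumerate (length ` {bs. P_sequence bs}) m \<longleftrightarrow>
   as = (P_step ^^ m) [1, -1]"
proof -
  have "length ` {bs. P_sequence bs} = range (\<lambda>m. length ((P_step ^^ m) [1, -1]))"
    by (auto simp: P_sequence_iff)
  then have "enumerate (length ` {bs. P_sequence bs}) m = length ((P_step ^^ m) [1, -1])"
    using enumerate_range_strict_mono[OF strict_mono_length_P_step] by simp
  then show ?thesis
    unfolding P_sequence_iff using strict_mono_eq[OF strict_mono_length_P_step] by metis
qed

lemma P_seq_ex1:
  "\<exists>!as. P_sequence as \<and> length as = enumerate (length ` {bs. P_sequence bs}) (n - 1)"
  unfolding length_P_sequence_iff by simp

lemma P_seq_eq_step: "P_seq n = (P_step ^^ (n - 1)) [1, -1]"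
  unfolding P_seq_def length_P_sequence_iff by simp

lemma "P_seq 1 = [1, -1]" "P_seq 2 = [1, -1, -1, 1]" "P_seq 3 = [1, -1, -1, 0, 1, 1, -1]"
  by (simp_all add: P_seq_eq_step P_step_def numeral_2_eq_2 numeral_3_eq_3)

end

(* Extend F to arbitrary integer lists as. A P-sequence satisfies rev as = as or
   rev as = - as, according to its last entry being 1 or -1. Consequently both
   construction steps add to as the negative of as, translated by some c > 0 (in the folding
   step the overlapping entries cancel to the 0 in the middle). On the polynomials this is the
   difference operator p(x) |-> p(x) - p(x + c), which lowers the degree by exactly one; and
   already F 1 s arises in this way from x^s. *)

theory Submission imports Defs begin

lemma degree_pcompose_shift:
  fixes p :: "'a::idom poly"
  shows "degree (p \<circ>\<^sub>p [:c, 1:]) = degree p"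
  by (simp add: degree_pcompose)

lemma lead_coeff_pcompose_shift:
  fixes p :: "'a::idom poly"
  shows "coeff (p \<circ>\<^sub>p [:c, 1:]) (degree p) = lead_coeff p"
  using lead_coeff_comp[of "[:c, 1:]" p] by (simp add: degree_pcompose_shift)

text \<open>The constant \<open>a\<close> cancels, leaving x q(x) - (x + c) q(x + c). This recursion
  drives the two inductions on \<open>p\<close> below.\<close>

lemma difference_pCons:
  fixes q :: "'a::idom poly"
  shows "pCons a q - pCons a q \<circ>\<^sub>p [:c, 1:] =
    pCons 0 (q - q \<circ>\<^sub>p [:c, 1:]) - smult c (q \<circ>\<^sub>p [:c, 1:])"
  by (simp add: pcompose_pCons algebra_simps)

lemma degree_difference_bound:
  fixes p :: "'a::idom poly"
  shows "degree (p - p \<circ>\<^sub>p [:c, 1:]) \<le> degree p - 1"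
proof (induction p)
  case (pCons a q)
  show ?case
  \<comment> \<open>A constant \<open>q\<close> is split off because truncated subtraction breaks
    \<open>degree q - 1 + 1 = degree q\<close> there.\<close>
  proof (cases "degree q")
    case 0
    then obtain b where "q = [:b:]" by (rule degree_eq_zeroE)
    then show ?thesis by (simp add: pcompose_pCons)
  next
    case (Suc d)
    have "degree (pCons 0 (q - q \<circ>\<^sub>p [:c, 1:])) \<le> degree q"
      using pCons.IH Suc by (intro order.trans[OF degree_pCons_le]) simp
    moreover have "degree (smult c (q \<circ>\<^sub>p [:c, 1:])) \<le> degree q"
      using degree_smult_le[of c "q \<circ>\<^sub>p [:c, 1:]"] by (simp add: degree_pcompose_shift)
    ultimately show ?thesis
      unfolding difference_pCons using Suc by (auto intro!: degree_diff_le simp: degree_pCons_eq_if)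
  qed
qed simp

lemma coeff_difference:
  fixes p :: "'a::idom poly"
  shows "coeff (p - p \<circ>\<^sub>p [:c, 1:]) (degree p - 1) = - of_nat (degree p) * c * lead_coeff p"
proof (induction p)
  case (pCons a q)
  show ?case
  proof (cases "degree q")
    case 0
    then obtain b where "q = [:b:]" by (rule degree_eq_zeroE)
    then show ?thesis by (simp add: pcompose_pCons)
  next
    case (Suc d)
    then have "q \<noteq> 0" by auto
    then show ?thesis
      \<comment> \<open>With d = \<open>degree q\<close>, the first summand of the recursion
        contributes -d c and the second -c, each times the leading coefficient of
        \<open>q\<close>.\<close>
      using pCons.IH Suc lead_coeff_pcompose_shift[of q c]
      unfolding difference_pCons by (simp add: algebra_simps)
  qed
qed simp

lemma degree_difference:
  fixes p :: "'a::{idom, ring_char_0} poly"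
  assumes "c \<noteq> 0" "degree p > 0"
  shows "p - p \<circ>\<^sub>p [:c, 1:] \<noteq> 0" "degree (p - p \<circ>\<^sub>p [:c, 1:]) = degree p - 1"
proof -
  \<comment> \<open>Characteristic zero enters here: \<open>degree p\<close> must not vanish as a
    scalar.\<close>
  have nz: "coeff (p - p \<circ>\<^sub>p [:c, 1:]) (degree p - 1) \<noteq> 0"
    using assms unfolding coeff_difference by auto
  then show "p - p \<circ>\<^sub>p [:c, 1:] \<noteq> 0" by (metis coeff_0)
  show "degree (p - p \<circ>\<^sub>p [:c, 1:]) = degree p - 1"
    using degree_difference_bound[of p c] le_degree[OF nz] by (rule antisym)
qed

definition shifted_power_sum :: "int list \<Rightarrow> nat \<Rightarrow> int poly" where
  "shifted_power_sum as s = (\<Sum>i<length as. smult (as ! i) ([:int i, 1:] ^ s))"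

lemma pcompose_power: "(p ^ n) \<circ>\<^sub>p q = (p \<circ>\<^sub>p q) ^ n"
  by (induction n) (simp_all add: pcompose_mult pcompose_1)

lemma shifted_power_sum_singleton: "shifted_power_sum [a] s = smult a ([:0, 1:] ^ s)"
  by (simp add: shifted_power_sum_def)

text \<open>Entry i of \<open>bs\<close> moves to index \<open>length as + i\<close>, which replaces
  x by x + \<open>length as\<close> in its power. Induction from the right leaves the earlier
  indices alone.\<close>

lemma shifted_power_sum_append:
  "shifted_power_sum (as @ bs) s =
     shifted_power_sum as s + shifted_power_sum bs s \<circ>\<^sub>p [:int (length as), 1:]"
proof (induction bs rule: rev_induct)
  case Nil
  show ?case by (simp add: shifted_power_sum_def)
next
  case (snoc b bs)
  have snoc_eq: "shifted_power_sum (xs @ [b]) s =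
      shifted_power_sum xs s + smult b ([:int (length xs), 1:] ^ s)" for xs
    by (simp add: shifted_power_sum_def nth_append)
  have "shifted_power_sum (as @ bs @ [b]) s =
      shifted_power_sum (as @ bs) s + smult b ([:int (length (as @ bs)), 1:] ^ s)"
    using snoc_eq[of "as @ bs"] by simp
  then show ?case
    by (simp add: snoc.IH snoc_eq pcompose_add pcompose_smult pcompose_power
      pcompose_pCons add_ac)
qed

lemma shifted_power_sum_uminus:
  "shifted_power_sum (map uminus as) s = - shifted_power_sum as s"
  by (simp add: shifted_power_sum_def sum_negf)

text \<open>The last construction step alone creates the symmetry: doubling yields a palindrome
  ending in 1, folding an antipalindrome ending in -1. The factor \<open>last as\<close> covers
  both.\<close>

lemma P_sequence_rev: "P_sequence as \<Longrightarrow> rev as = map ((*) (last as)) as"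
proof (induction rule: P_sequence.induct)
  case (double as)
  have "last (as @ rev as) = 1"
    using double.hyps P_sequence_shape[of as] by (auto simp: last_append last_rev)
  then show ?case by simp
next
  case (fold_zero as)
  then have "length as \<ge> 2" "hd as = 1" using P_sequence_shape by auto
  then obtain y bs where "as = 1 # y # bs"
    by (auto simp: numeral_2_eq_2 Suc_le_length_iff)
  then have "last (butlast as @ [0] @ map uminus (rev (butlast as))) = -1" by simp
  then show ?case by (simp add: rev_map)
qed simp

lemma shifted_power_sum_P_step:
  assumes "P_sequence as"
  obtains c where "c > 0" "\<And>s. shifted_power_sum (P_step as) s =
    shifted_power_sum as s - shifted_power_sum as s \<circ>\<^sub>p [:c, 1:]"
proof (cases "last as = 1")
  case False
  have shape: "length as \<ge> 2" "hd as = 1" "last as = -1"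
    using P_sequence_shape[OF assms] False by auto
  have "P_step as = as @ map uminus as"
    using shape P_sequence_rev[OF assms] by (simp add: P_step_def)
  then show thesis
    using shape by (intro that[of "int (length as)"])
      (auto simp: shifted_power_sum_append shifted_power_sum_uminus pcompose_uminus)
next
  case True
  have shape: "length as \<ge> 2" "hd as = 1"
    using P_sequence_shape[OF assms] by auto
  define bs where "bs = butlast as"
  have as: "as = bs @ [1]"
    using shape True by (metis append_butlast_last_id bs_def list.size(3) not_numeral_le_zero)
  have len: "length bs > 0" using shape as by (cases bs) auto
  \<comment> \<open>The palindrome \<open>as\<close> is read in two ways, with its final 1 split off
    (\<open>as\<close>) or its initial 1 (\<open>sym\<close>).\<close>
  have sym: "1 # rev bs = as"
    using P_sequence_rev[OF assms] True by (simp add: as map_idI)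
  have step: "P_step as = bs @ [0] @ map uminus (rev bs)"
    using shape True by (simp add: P_step_def bs_def)
  show thesis
  \<comment> \<open>The shift is one less than \<open>length as\<close>: the last entry 1 of
    \<open>as\<close> and the first entry -1 of the negated copy meet at index
    \<open>length bs\<close> and give the 0.\<close>
  proof (rule that[of "int (length bs)"])
    fix s
    define S where "S = shifted_power_sum (rev bs) s \<circ>\<^sub>p [:1, 1:]"
    let ?x = "[:0, 1:] ^ s :: int poly"
    have "shifted_power_sum as s = ?x + S"
      using shifted_power_sum_append[of "[1]" "rev bs" s]
      by (simp add: sym S_def shifted_power_sum_singleton)
    then have comp: "shifted_power_sum as s \<circ>\<^sub>p [:int (length bs), 1:] =
        ?x \<circ>\<^sub>p [:int (length bs), 1:] + S \<circ>\<^sub>p [:int (length bs), 1:]"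
      by (simp only: pcompose_add)
    \<comment> \<open>The leading 0 contributes nothing itself but moves the other entries by 1, as
      in \<open>S\<close>.\<close>
    have tail: "shifted_power_sum ([0] @ map uminus (rev bs)) s = - S"
      unfolding shifted_power_sum_append shifted_power_sum_uminus pcompose_uminus
      by (simp add: S_def shifted_power_sum_singleton)
    have init: "shifted_power_sum as s =
        shifted_power_sum bs s + ?x \<circ>\<^sub>p [:int (length bs), 1:]"
      unfolding as shifted_power_sum_append by (simp add: shifted_power_sum_singleton)
    show "shifted_power_sum (P_step as) s =
        shifted_power_sum as s - shifted_power_sum as s \<circ>\<^sub>p [:int (length bs), 1:]"
      unfolding step shifted_power_sum_append[of bs] tail comp pcompose_uminus
      by (simp only: init)
  qed (use len in simp)
qed

text \<open>The bound on \<open>s\<close> keeps the degree positive before each difference is taken.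
  Nonvanishing is stated separately since the zero polynomial also has degree 0, the value reached
  at \<open>s = Suc m\<close>.\<close>

lemma degree_shifted_power_sum_funpow_P_step:
  assumes "s > m"
  shows "shifted_power_sum ((P_step ^^ m) [1, -1]) s \<noteq> 0 \<and>
    degree (shifted_power_sum ((P_step ^^ m) [1, -1]) s) = s - Suc m"
  using assms
proof (induction m)
  case 0
  let ?x = "[:0, 1:] ^ s :: int poly"
  have "shifted_power_sum ([1] @ map uminus [1]) s = ?x - ?x \<circ>\<^sub>p [:1, 1:]"
    unfolding shifted_power_sum_append shifted_power_sum_uminus
    by (simp add: shifted_power_sum_singleton pcompose_uminus)
  moreover have "degree ?x = s" by (simp add: degree_power_eq)
  ultimately show ?case using degree_difference[of 1 ?x] 0 by simp
next
  case (Suc m)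
  have "P_sequence ((P_step ^^ m) [1, -1])" unfolding P_sequence_iff by blast
  then obtain c where c: "c > 0" "shifted_power_sum (P_step ((P_step ^^ m) [1, -1])) s =
      shifted_power_sum ((P_step ^^ m) [1, -1]) s
        - shifted_power_sum ((P_step ^^ m) [1, -1]) s \<circ>\<^sub>p [:c, 1:]"
    by (metis shifted_power_sum_P_step)
  then show ?case
    using Suc degree_difference[of c "shifted_power_sum ((P_step ^^ m) [1, -1]) s"] by simp
qed

theorem theorem1:
  fixes n :: nat
  assumes "n \<ge> 1"
  shows "(\<forall>s\<ge>n. F n s \<noteq> 0 \<and> degree (F n s) = s - n) \<and> (\<exists>c. c \<noteq> 0 \<and> F n n = [:c:])"
proof -
  have "F n s = shifted_power_sum ((P_step ^^ (n - 1)) [1, -1]) s" for s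
    by (simp add: F_def shifted_power_sum_def P_seq_eq_step)
  then have deg: "F n s \<noteq> 0 \<and> degree (F n s) = s - n" if "s \<ge> n" for s
    using degree_shifted_power_sum_funpow_P_step[of "n - 1" s] assms that by simp
  moreover have "\<exists>c. c \<noteq> 0 \<and> F n n = [:c:]"
    using deg[of n] by (metis degree_eq_zeroE diff_self_eq_0 order_refl pCons_0_0)
  ultimately show ?thesis by blast
qed

end
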